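(* Let $A$ be a finite nonempty set and $m\ge 2$. (A) Let $\theta\subseteq A^m$ be an $m$-ary generalized equivalence relation. Then: (i) The binary symmetric part $\theta^{[2]}$ completely determines $\theta$, namely $$(a_1,\dots,a_m)\in\theta\iff\forall i,j\in\{1,\dots,m\}:(a_i,a_j)\in\theta^{[2]}.$$ (ii) $\mathrm{abs}(\theta)=\theta$; in particular, $\theta$ is absolutely symmetric. (B) Let $\psi$ be an equivalence relation on $A$. Then $$\psi^{\updownarrow m}:=\{(a_1,\dots,a_m)\in A^m\mid\forall i,j\in\{1,\dots,m\}:(a_i,a_j)\in\psi\}$$ is a generalized equivalence relation. (C) We have $(\psi^{\updownarrow m})^{[2]}=\psi$ and $(\theta^{[2]})^{\updownarrow m}=\theta$ for every equivalence relation $\psi\in\mathrm{Eq}(A)$ and every $\theta\in\mathrm{gEq}^{(m)}(A)$. The mappings $\psi\mapsto\psi^{\updownarrow m}$ and $\theta\mapsto\theta^{[2]}$ are isomorphisms between the lattices $\mathrm{Eq}(A)$ and $\mathrm{gEq}^{(m)}(A)$ (ordered by inclusion).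
   Context: A relation $\rho\subseteq A^m$ is reflexive if $(a,\dots,a)\in\rho$ for all $a\in A$; it is (generalized) transitive if for every matrix $(a_{ij})\in A^{m\times m}$ all of whose rows and all of whose columns belong to $\rho$, the diagonal $(a_{11},\dots,a_{mm})$ belongs to $\rho$. It is totally symmetric (resp. absolutely symmetric) if $(a_1,\dots,a_m)\in\rho$ implies $(a_{\alpha 1},\dots,a_{\alpha m})\in\rho$ for all permutations $\alpha$ of $\{1,\dots,m\}$ (resp. for all mappings $\alpha:\{1,\dots,m\}\to\{1,\dots,m\}$). A generalized equivalence relation is a reflexive, totally symmetric and transitive relation; $\mathrm{gEq}^{(m)}(A)$ is the set of all $m$-ary ones, and $\mathrm{Eq}(A)$ is the set of all (binary) equivalence relations on $A$. For $\rho\subseteq A^m$: $\mathrm{abs}(\rho):=\{(a_1,\dots,a_m)\mid\{a_1,\dots,a_m\}^m\subseteq\rho\}$ and $\rho^{[2]}:=\{(a,b)\in A^2\mid\{a,b\}^m\subseteq\rho\}$ (the binary symmetric part). *)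

theory Defs
  imports "HOL-Algebra.Lattice" "HOL-Library.FuncSet" "HOL-Combinatorics.Permutations"
begin

text \<open>
  An \<open>m\<close>-tuple over \<open>A\<close> is an extensional function on the index set \<open>{1..m}\<close> with values in \<open>A\<close>.
  Tuples obtained from other functions are therefore cut down with \<^const>\<open>restrict\<close>.
\<close>

definition tuples :: "nat \<Rightarrow> 'a set \<Rightarrow> (nat \<Rightarrow> 'a) set" where
  "tuples m A = {1..m} \<rightarrow>\<^sub>E A"

definition reflexive_rel :: "nat \<Rightarrow> 'a set \<Rightarrow> (nat \<Rightarrow> 'a) set \<Rightarrow> bool" where
  "reflexive_rel m A \<rho> \<longleftrightarrow> (\<forall>a\<in>A. (\<lambda>i\<in>{1..m}. a) \<in> \<rho>)"

definition transitive_rel :: "nat \<Rightarrow> 'a set \<Rightarrow> (nat \<Rightarrow> 'a) set \<Rightarrow> bool" where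
  "transitive_rel m A \<rho> \<longleftrightarrow>
     (\<forall>M :: nat \<Rightarrow> nat \<Rightarrow> 'a.
        (\<forall>i\<in>{1..m}. \<forall>j\<in>{1..m}. M i j \<in> A) \<longrightarrow>
        (\<forall>i\<in>{1..m}. (\<lambda>j\<in>{1..m}. M i j) \<in> \<rho>) \<longrightarrow>
        (\<forall>j\<in>{1..m}. (\<lambda>i\<in>{1..m}. M i j) \<in> \<rho>) \<longrightarrow>
        (\<lambda>i\<in>{1..m}. M i i) \<in> \<rho>)"

definition totally_symmetric :: "nat \<Rightarrow> (nat \<Rightarrow> 'a) set \<Rightarrow> bool" where
  "totally_symmetric m \<rho> \<longleftrightarrow>
     (\<forall>a\<in>\<rho>. \<forall>\<alpha>. \<alpha> permutes {1..m} \<longrightarrow> (\<lambda>i\<in>{1..m}. a (\<alpha> i)) \<in> \<rho>)"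

definition absolutely_symmetric :: "nat \<Rightarrow> (nat \<Rightarrow> 'a) set \<Rightarrow> bool" where
  "absolutely_symmetric m \<rho> \<longleftrightarrow>
     (\<forall>a\<in>\<rho>. \<forall>\<alpha>. \<alpha> \<in> {1..m} \<rightarrow> {1..m} \<longrightarrow> (\<lambda>i\<in>{1..m}. a (\<alpha> i)) \<in> \<rho>)"

definition gEq :: "nat \<Rightarrow> 'a set \<Rightarrow> (nat \<Rightarrow> 'a) set set" where
  "gEq m A =
     {\<rho>. \<rho> \<subseteq> tuples m A \<and> reflexive_rel m A \<rho> \<and> totally_symmetric m \<rho> \<and> transitive_rel m A \<rho>}"

definition Eq :: "'a set \<Rightarrow> ('a \<times> 'a) set set" where
  "Eq A = {\<psi>. equiv A \<psi>}"

definition abs_part :: "nat \<Rightarrow> 'a set \<Rightarrow> (nat \<Rightarrow> 'a) set \<Rightarrow> (nat \<Rightarrow> 'a) set" where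
  "abs_part m A \<rho> = {a \<in> tuples m A. tuples m (a ` {1..m}) \<subseteq> \<rho>}"

definition bin_sym_part :: "nat \<Rightarrow> 'a set \<Rightarrow> (nat \<Rightarrow> 'a) set \<Rightarrow> ('a \<times> 'a) set" where
  "bin_sym_part m A \<rho> = {(a, b) \<in> A \<times> A. tuples m {a, b} \<subseteq> \<rho>}"

definition blow_up :: "nat \<Rightarrow> 'a set \<Rightarrow> ('a \<times> 'a) set \<Rightarrow> (nat \<Rightarrow> 'a) set" where
  "blow_up m A \<psi> = {a \<in> tuples m A. \<forall>i\<in>{1..m}. \<forall>j\<in>{1..m}. (a i, a j) \<in> \<psi>}"

definition inclusion_order :: "'b set set \<Rightarrow> 'b set gorder" where
  "inclusion_order S = \<lparr>carrier = S, eq = (=), le = (\<subseteq>)\<rparr>"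

text \<open>
  \<^const>\<open>join_pres\<close> and \<^const>\<open>meet_pres\<close> include the requirement that both orders are lattices.
\<close>

definition lattice_iso ::
  "('a, 'c) gorder_scheme \<Rightarrow> ('b, 'd) gorder_scheme \<Rightarrow> ('a \<Rightarrow> 'b) \<Rightarrow> bool" where
  "lattice_iso X Y f \<longleftrightarrow> bij_betw f (carrier X) (carrier Y) \<and> join_pres X Y f \<and> meet_pres X Y f"

end

theory Submission
  imports Defs
begin

text \<open>
  Transitivity is used only through two kinds of matrices. If every off-diagonal entry is \<open>b\<close>, each
  row and each column agrees with the constant tuple \<open>b\<close> except in one place, so a tuple \<open>t\<close> belongs
  to \<open>\<theta>\<close> as soon as \<open>\<theta>\<close> contains every tuple obtained from the constant tuple \<open>b\<close> by putting \<open>t i\<close>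
  at place \<open>i\<close>. This reduces absolute symmetry to tuples with a single deviating entry. To obtain
  those from \<open>a \<in> \<theta>\<close>, take the cyclic Latin square on \<open>a 1, \<dots>, a (m - 1)\<close> with constant diagonal
  \<open>a 1\<close> and border it by a row and a column that are constantly \<open>a m\<close>: all rows and columns are
  constant or permutations of \<open>a\<close>, and the diagonal is \<open>(a 1, \<dots>, a 1, a m)\<close>.
\<close>

section \<open>Generalized equivalence relations\<close>

declare One_nat_def [simp del]

lemma gEqD:
  assumes "\<theta> \<in> gEq m A"
  shows gEq_tuples: "\<theta> \<subseteq> tuples m A"
    and gEq_const: "\<And>a. a \<in> A \<Longrightarrow> (\<lambda>i\<in>{1..m}. a) \<in> \<theta>"
    and gEq_permute: "\<And>a \<alpha>. a \<in> \<theta> \<Longrightarrow> \<alpha> permutes {1..m} \<Longrightarrow> (\<lambda>i\<in>{1..m}. a (\<alpha> i)) \<in> \<theta>"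
  using assms by (auto simp: gEq_def reflexive_rel_def totally_symmetric_def)

lemma gEq_entry:
  assumes "\<theta> \<in> gEq m A" "a \<in> \<theta>" "i \<in> {1..m}"
  shows "a i \<in> A"
  using gEq_tuples[OF assms(1)] assms(2,3) PiE_mem unfolding tuples_def by blast

lemma tuples_restrict: "t \<in> tuples m A \<Longrightarrow> (\<lambda>i\<in>{1..m}. t i) = t"
  unfolding tuples_def by (rule PiE_restrict)

section \<open>Diagonals of matrices with rows and columns in a generalized equivalence
  relation\<close>

lemma gEq_diagonal:
  assumes "\<theta> \<in> gEq m A"
    and rows: "\<And>i. i \<in> {1..m} \<Longrightarrow> (\<lambda>j\<in>{1..m}. M i j) \<in> \<theta>"
    and cols: "\<And>j. j \<in> {1..m} \<Longrightarrow> (\<lambda>i\<in>{1..m}. M i j) \<in> \<theta>"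
  shows "(\<lambda>i\<in>{1..m}. M i i) \<in> \<theta>"
proof -
  \<comment> \<open>The side condition of \<open>transitive_rel\<close> that entries lie in
    \<open>A\<close> comes for free: each entry belongs to a row in \<open>\<theta>\<close>.\<close>
  have "M i j \<in> A" if "i \<in> {1..m}" "j \<in> {1..m}" for i j
    using gEq_entry[OF assms(1) rows[OF that(1)] that(2)] that(2) by simp
  moreover have "transitive_rel m A \<theta>"
    using assms(1) by (simp add: gEq_def)
  ultimately show ?thesis
    using rows cols by (simp add: transitive_rel_def)
qed

text \<open>The matrix with diagonal \<open>t\<close> and \<open>b\<close> elsewhere has equal
  \<open>i\<close>-th row and column, so one family of hypotheses covers both. Different choices of
  the background value \<open>b\<close> yield absolute symmetry, the reduction to pairs, and
  transitivity of the binary symmetric part.\<close>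

lemma gEq_of_single_deviations:
  assumes "\<theta> \<in> gEq m A"
    and dev: "\<And>i. i \<in> {1..m} \<Longrightarrow> (\<lambda>j\<in>{1..m}. if j = i then t i else b) \<in> \<theta>"
  shows "(\<lambda>i\<in>{1..m}. t i) \<in> \<theta>"
proof -
  let ?M = "\<lambda>i j. if i = j then t i else b"
  have "(\<lambda>i\<in>{1..m}. ?M i i) \<in> \<theta>"
  proof (rule gEq_diagonal[OF assms(1), of ?M])
    fix i assume "i \<in> {1..m}"
    have "(\<lambda>j\<in>{1..m}. ?M i j) = (\<lambda>j\<in>{1..m}. if j = i then t i else b)"
      "(\<lambda>j\<in>{1..m}. ?M j i) = (\<lambda>j\<in>{1..m}. if j = i then t i else b)"
      by (auto simp: fun_eq_iff restrict_def)
    with dev[OF \<open>i \<in> {1..m}\<close>]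
    show "(\<lambda>j\<in>{1..m}. ?M i j) \<in> \<theta>" "(\<lambda>j\<in>{1..m}. ?M j i) \<in> \<theta>" by simp_all
  qed
  then show ?thesis by simp
qed

text \<open>The cyclic Latin square of order \<open>n\<close>: residues of \<open>i - j\<close>,
  shifted by \<open>Suc\<close> to the index range \<open>{1..n}\<close>. The difference is taken in
  the integers because subtraction on \<open>nat\<close> truncates.\<close>

definition cyc :: "nat \<Rightarrow> nat \<Rightarrow> nat \<Rightarrow> nat" where
  "cyc n i j = Suc (nat ((int i - int j) mod int n))"

lemma cyc_mem: "0 < n \<Longrightarrow> cyc n i j \<in> {1..n}"
  by (simp add: cyc_def nat_less_iff Suc_le_eq)

lemma cyc_diag: "cyc n i i = 1"
  by (simp add: cyc_def)

text \<open>A nonzero multiple of \<open>n\<close> has absolute value at least \<open>n\<close>,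
  while two indices from \<open>{1..n}\<close> differ by less.\<close>

lemma eq_if_int_dvd_diff:
  fixes i j n :: nat
  assumes "i \<in> {1..n}" "j \<in> {1..n}" "int n dvd int i - int j"
  shows "i = j"
proof (rule ccontr)
  assume "i \<noteq> j"
  then have "\<bar>int n\<bar> \<le> \<bar>int i - int j\<bar>"
    using assms(3) by (intro dvd_imp_le_int) auto
  with assms(1,2) show False by auto
qed

text \<open>The Latin square property: equal entries mean congruent index differences, so when one
  index is fixed the other is determined modulo \<open>n\<close>.\<close>

lemma inj_on_cyc:
  assumes "0 < n"
  shows "inj_on (\<lambda>j. cyc n i j) {1..n}" and "inj_on (\<lambda>i. cyc n i j) {1..n}"
proof -
  have *: "int n dvd (int i - int j) - (int i' - int j')" if "cyc n i j = cyc n i' j'" for i j i' j'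
  proof -
    have "(int i - int j) mod int n = (int i' - int j') mod int n"
      using that assms eq_nat_nat_iff[OF pos_mod_sign pos_mod_sign] by (simp add: cyc_def)
    then show ?thesis by (simp only: mod_eq_dvd_iff)
  qed
  \<comment> \<open>With the row fixed, the column indices appear in reversed order in the
    difference, hence \<open>sym\<close>.\<close>
  show "inj_on (\<lambda>j. cyc n i j) {1..n}"
    by (rule inj_onI, rule sym, rule eq_if_int_dvd_diff, assumption, assumption) (drule *, simp)
  show "inj_on (\<lambda>i. cyc n i j) {1..n}"
    by (rule inj_onI, rule eq_if_int_dvd_diff, assumption, assumption) (drule *, simp)
qed

text \<open>An injective self-map of a finite set is onto. Continuing it by the identity leaves the
  border index \<open>m\<close> fixed when \<open>n = m - 1\<close>.\<close>

lemma inj_on_self_map_permutes: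
  assumes "inj_on f {1..n}" "f \<in> {1..n} \<rightarrow> {1..n}" "n \<le> m"
  shows "(\<lambda>j. if j \<in> {1..n} then f j else j) permutes {1..m :: nat}"
proof -
  have "bij_betw f {1..n} {1..n}"
    unfolding bij_betw_def using assms(1,2) endo_inj_surj[of "{1..n}" f]
    by (simp add: image_subset_iff_funcset)
  then have "bij_betw (\<lambda>j. if j \<in> {1..n} then f j else j) {1..n} {1..n}"
    by (subst bij_betw_cong[of _ _ f]) auto
  then have "(\<lambda>j. if j \<in> {1..n} then f j else j) permutes {1..n}"
    by (rule bij_imp_permutes) auto
  then show ?thesis
    by (rule permutes_subset) (use assms(3) in auto)
qed

lemma gEq_first_last:
  assumes "\<theta> \<in> gEq m A" "2 \<le> m" "a \<in> \<theta>"
  shows "(\<lambda>i\<in>{1..m}. if i = m then a m else a 1) \<in> \<theta>"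
proof -
  define n where "n = m - 1"
  have n: "0 < n" "m = Suc n" "n \<le> m"
    using assms(2) by (auto simp: n_def)
  let ?M = "\<lambda>i j. if i = m \<or> j = m then a m else a (cyc n i j)"
  have border: "(\<lambda>i\<in>{1..m}. a m) \<in> \<theta>"
    using assms(2) by (intro gEq_const[OF assms(1)] gEq_entry[OF assms(1,3)]) simp
  have "(\<lambda>i\<in>{1..m}. ?M i i) \<in> \<theta>"
  proof (rule gEq_diagonal[OF assms(1), of ?M])
    fix i assume i: "i \<in> {1..m}"
    have perm: "(\<lambda>j. if j \<in> {1..n} then f j else j) permutes {1..m}"
      if "f = (\<lambda>j. cyc n i j) \<or> f = (\<lambda>j. cyc n j i)" for f
      using that cyc_mem[OF n(1)] inj_on_cyc[OF n(1)] n(3)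
      by (intro inj_on_self_map_permutes) auto
    have "(\<lambda>j\<in>{1..m}. ?M i j) \<in> \<theta> \<and> (\<lambda>j\<in>{1..m}. ?M j i) \<in> \<theta>"
    proof (cases "i = m")
      case True
      then show ?thesis using border by simp
    next
      case False
      \<comment> \<open>A row or column other than the border is a permuted copy of
        \<open>a\<close>: the places in \<open>{1..n}\<close> are permuted by \<open>cyc\<close>,
        and place \<open>m\<close> keeps \<open>a m\<close>.\<close>
      then have "(\<lambda>j\<in>{1..m}. ?M i j)
          = (\<lambda>j\<in>{1..m}. a ((\<lambda>j. if j \<in> {1..n} then cyc n i j else j) j))"
        "(\<lambda>j\<in>{1..m}. ?M j i)
          = (\<lambda>j\<in>{1..m}. a ((\<lambda>j. if j \<in> {1..n} then cyc n j i else j) j))"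
        using n by (auto simp: fun_eq_iff restrict_def)
      then show ?thesis
        using gEq_permute[OF assms(1,3) perm] by simp
    qed
    then show "(\<lambda>j\<in>{1..m}. ?M i j) \<in> \<theta>" "(\<lambda>j\<in>{1..m}. ?M j i) \<in> \<theta>" by simp_all
  qed
  moreover have "(\<lambda>i\<in>{1..m}. ?M i i) = (\<lambda>i\<in>{1..m}. if i = m then a m else a 1)"
    by (simp add: cyc_diag cong: if_cong)
  ultimately show ?thesis by simp
qed

text \<open>For \<open>k \<noteq> l\<close>, total symmetry moves \<open>a l\<close> to the first
  and \<open>a k\<close> to the last place; \<open>gEq_first_last\<close> then applies, and a swap
  brings the deviating entry from place \<open>m\<close> to place \<open>i\<close>. For
  \<open>k = l\<close> the tuple is constant.\<close>

lemma gEq_single_deviation: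
  assumes "\<theta> \<in> gEq m A" "2 \<le> m" "a \<in> \<theta>"
    and kli: "k \<in> {1..m}" "l \<in> {1..m}" "i \<in> {1..m}"
  shows "(\<lambda>j\<in>{1..m}. if j = i then a k else a l) \<in> \<theta>"
proof (cases "k = l")
  case True
  moreover have "a l \<in> A"
    using gEq_entry[OF assms(1,3) kli(2)] .
  ultimately show ?thesis
    using gEq_const[OF assms(1)] by (simp cong: if_cong)
next
  case False
  have "\<exists>p. p permutes {1..m} \<and> p 1 = l \<and> p m = k"
  proof (intro exI conjI)
    \<comment> \<open>The inner swap sends \<open>1\<close> to \<open>l\<close> and \<open>m\<close>
      to some index other than \<open>l\<close>; the outer swap takes that index to \<open>k\<close>
      and fixes \<open>l\<close>, because \<open>k \<noteq> l\<close>.\<close>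
    let ?p = "transpose (transpose 1 l m) k \<circ> transpose 1 l"
    have "transpose 1 l m \<in> {1..m}" "transpose 1 l m \<noteq> l"
      using assms(2) kli by (auto simp: transpose_def)
    then show "?p permutes {1..m}" "?p 1 = l" "?p m = k"
      using assms(2) kli False
      by (auto intro!: permutes_compose permutes_swap_id)
  qed
  then obtain p where p: "p permutes {1..m}" "p 1 = l" "p m = k" by blast
  have "(\<lambda>j\<in>{1..m}. if j = m then a k else a l) \<in> \<theta>"
    using gEq_first_last[OF assms(1,2) gEq_permute[OF assms(1,3) p(1)]] p assms(2)
    by (simp cong: if_cong)
  then have "(\<lambda>j\<in>{1..m}. (\<lambda>j\<in>{1..m}. if j = m then a k else a l) (transpose i m j)) \<in> \<theta>"
    by (rule gEq_permute[OF assms(1)]) (use assms(2) kli in \<open>auto intro: permutes_swap_id\<close>)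
  moreover have "(\<lambda>j\<in>{1..m}. (\<lambda>j\<in>{1..m}. if j = m then a k else a l) (transpose i m j))
      = (\<lambda>j\<in>{1..m}. if j = i then a k else a l)"
    using assms(2) kli by (auto simp: fun_eq_iff restrict_def transpose_def)
  ultimately show ?thesis by simp
qed

text \<open>With \<open>a 1\<close> as background value, every required single deviation has both
  its values among the entries of \<open>a\<close>.\<close>

lemma gEq_range_tuples:
  assumes "\<theta> \<in> gEq m A" "2 \<le> m" "a \<in> \<theta>"
  shows "tuples m (a ` {1..m}) \<subseteq> \<theta>"
proof
  fix t assume t: "t \<in> tuples m (a ` {1..m})"
  have "(\<lambda>i\<in>{1..m}. t i) \<in> \<theta>"
  proof (rule gEq_of_single_deviations[OF assms(1)])
    fix i assume i: "i \<in> {1..m}"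
    then have "t i \<in> a ` {1..m}"
      using t PiE_mem unfolding tuples_def by blast
    then obtain k where "k \<in> {1..m}" "t i = a k"
      by blast
    then show "(\<lambda>j\<in>{1..m}. if j = i then t i else a 1) \<in> \<theta>"
      using gEq_single_deviation[OF assms _ _ i, of k 1] assms(2) by (simp cong: if_cong)
  qed
  then show "t \<in> \<theta>"
    using t by (simp add: tuples_restrict)
qed

section \<open>The absolutely symmetric part and absolute symmetry\<close>

lemma abs_part_gEq:
  assumes "\<theta> \<in> gEq m A" "2 \<le> m"
  shows "abs_part m A \<theta> = \<theta>"
proof
  \<comment> \<open>Every tuple is a tuple over its own range.\<close>
  show "abs_part m A \<theta> \<subseteq> \<theta>"
    by (auto simp: abs_part_def tuples_def PiE_iff subset_iff)
  show "\<theta> \<subseteq> abs_part m A \<theta>"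
    using gEq_range_tuples[OF assms] gEq_tuples[OF assms(1)] unfolding abs_part_def by blast
qed

lemma gEq_absolutely_symmetric:
  assumes "\<theta> \<in> gEq m A" "2 \<le> m"
  shows "absolutely_symmetric m \<theta>"
  unfolding absolutely_symmetric_def
proof (intro ballI allI impI)
  fix a \<alpha> assume "a \<in> \<theta>" "\<alpha> \<in> {1..m} \<rightarrow> {1..m}"
  then show "(\<lambda>i\<in>{1..m}. a (\<alpha> i)) \<in> \<theta>"
    using gEq_range_tuples[OF assms, of a] by (force simp: tuples_def PiE_iff)
qed

section \<open>The binary symmetric part and its inverse\<close>

lemma bin_sym_part_sym: "(a, b) \<in> bin_sym_part m A \<rho> \<Longrightarrow> (b, a) \<in> bin_sym_part m A \<rho>"
  by (auto simp: bin_sym_part_def insert_commute)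

lemma restrict_mem_of_bin_sym_part:
  assumes "(a, b) \<in> bin_sym_part m A \<rho>" "\<And>j. j \<in> {1..m} \<Longrightarrow> t j \<in> {a, b}"
  shows "(\<lambda>j\<in>{1..m}. t j) \<in> \<rho>"
proof -
  have "tuples m {a, b} \<subseteq> \<rho>"
    using assms(1) by (simp add: bin_sym_part_def)
  moreover have "(\<lambda>j\<in>{1..m}. t j) \<in> tuples m {a, b}"
    unfolding tuples_def using assms(2) by (intro restrict_PiE[THEN iffD2] Pi_I)
  ultimately show ?thesis by blast
qed

text \<open>Forwards, tuples over two entries of \<open>a\<close> are tuples over its range.
  Backwards, the pair \<open>(a i, a 1)\<close> supplies the tuple that is \<open>a i\<close> at
  place \<open>i\<close> and \<open>a 1\<close> elsewhere, and these single deviations assemble to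
  \<open>a\<close>.\<close>

lemma gEq_iff_bin_sym_part:
  assumes "\<theta> \<in> gEq m A" "2 \<le> m" "a \<in> tuples m A"
  shows "a \<in> \<theta> \<longleftrightarrow> (\<forall>i\<in>{1..m}. \<forall>j\<in>{1..m}. (a i, a j) \<in> bin_sym_part m A \<theta>)"
proof
  assume a: "a \<in> \<theta>"
  show "\<forall>i\<in>{1..m}. \<forall>j\<in>{1..m}. (a i, a j) \<in> bin_sym_part m A \<theta>"
  proof (intro ballI)
    fix i j assume ij: "i \<in> {1..m}" "j \<in> {1..m}"
    then have "tuples m {a i, a j} \<subseteq> tuples m (a ` {1..m})"
      unfolding tuples_def by (intro PiE_mono) auto
    then show "(a i, a j) \<in> bin_sym_part m A \<theta>"
      using gEq_range_tuples[OF assms(1,2) a] assms(3) ij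
      by (auto simp: bin_sym_part_def tuples_def)
  qed
next
  assume pairs: "\<forall>i\<in>{1..m}. \<forall>j\<in>{1..m}. (a i, a j) \<in> bin_sym_part m A \<theta>"
  have "(\<lambda>i\<in>{1..m}. a i) \<in> \<theta>"
  proof (rule gEq_of_single_deviations[OF assms(1)])
    fix i assume "i \<in> {1..m}"
    then have "(a i, a 1) \<in> bin_sym_part m A \<theta>"
      using pairs assms(2) by simp
    then show "(\<lambda>j\<in>{1..m}. if j = i then a i else a 1) \<in> \<theta>"
      by (rule restrict_mem_of_bin_sym_part) simp
  qed
  then show "a \<in> \<theta>"
    using assms(3) by (simp add: tuples_restrict)
qed

lemma bin_sym_part_Eq:
  assumes "\<theta> \<in> gEq m A" "2 \<le> m"
  shows "bin_sym_part m A \<theta> \<in> Eq A"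
proof -
  let ?\<psi> = "bin_sym_part m A \<theta>"
  have "?\<psi> \<subseteq> A \<times> A"
    by (auto simp: bin_sym_part_def)
  moreover have "(a, a) \<in> ?\<psi>" if "a \<in> A" for a
  proof -
    have "t = (\<lambda>i\<in>{1..m}. a)" if "t \<in> tuples m {a, a}" for t
      using that by (auto simp: tuples_def fun_eq_iff PiE_iff extensional_def)
    then show ?thesis
      using that gEq_const[OF assms(1) that] by (auto simp: bin_sym_part_def)
  qed
  moreover have "trans ?\<psi>"
  proof (rule transI)
    fix a b c assume ab: "(a, b) \<in> ?\<psi>" and bc: "(b, c) \<in> ?\<psi>"
    have "t \<in> \<theta>" if t: "t \<in> tuples m {a, c}" for t
    proof -
      \<comment> \<open>The middle element \<open>b\<close> serves as background: a deviating entry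
        is \<open>a\<close> or \<open>c\<close>, so each single deviation is a tuple over
        \<open>{a, b}\<close> or over \<open>{b, c}\<close>.\<close>
      have "(\<lambda>i\<in>{1..m}. t i) \<in> \<theta>"
      proof (rule gEq_of_single_deviations[OF assms(1)])
        fix i assume "i \<in> {1..m}"
        then have "t i = a \<or> t i = c"
          using t by (auto simp: tuples_def PiE_iff)
        then show "(\<lambda>j\<in>{1..m}. if j = i then t i else b) \<in> \<theta>"
          using restrict_mem_of_bin_sym_part[OF ab] restrict_mem_of_bin_sym_part[OF bc] by auto
      qed
      then show ?thesis
        using t by (simp add: tuples_restrict)
    qed
    then show "(a, c) \<in> ?\<psi>"
      using ab bc by (auto simp: bin_sym_part_def)
  qed
  ultimately show ?thesis
    using bin_sym_part_sym by (auto simp: Eq_def intro!: equivI refl_onI symI)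
qed

section \<open>From equivalence relations to generalized ones and back\<close>

lemma blow_up_gEq:
  assumes "\<psi> \<in> Eq A"
  shows "blow_up m A \<psi> \<in> gEq m A"
proof -
  have refl: "\<And>x. x \<in> A \<Longrightarrow> (x, x) \<in> \<psi>" and trans: "trans \<psi>"
    using assms by (auto simp: Eq_def equiv_def refl_on_def)
  have "totally_symmetric m (blow_up m A \<psi>)"
    unfolding totally_symmetric_def
  proof (intro ballI allI impI)
    fix a \<alpha> assume "a \<in> blow_up m A \<psi>" "\<alpha> permutes {1..m}"
    moreover from this have "\<And>i. i \<in> {1..m} \<Longrightarrow> \<alpha> i \<in> {1..m}"
      by (simp only: permutes_in_image)
    ultimately show "(\<lambda>i\<in>{1..m}. a (\<alpha> i)) \<in> blow_up m A \<psi>"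
      by (simp add: blow_up_def tuples_def PiE_iff)
  qed
  moreover have "transitive_rel m A (blow_up m A \<psi>)"
    unfolding transitive_rel_def
  proof (intro allI impI)
    fix M :: "nat \<Rightarrow> nat \<Rightarrow> 'a"
    assume M: "\<forall>i\<in>{1..m}. \<forall>j\<in>{1..m}. M i j \<in> A"
      and rows: "\<forall>i\<in>{1..m}. (\<lambda>j\<in>{1..m}. M i j) \<in> blow_up m A \<psi>"
      and cols: "\<forall>j\<in>{1..m}. (\<lambda>i\<in>{1..m}. M i j) \<in> blow_up m A \<psi>"
    \<comment> \<open>The entry \<open>M i j\<close> links the two diagonal entries: it shares row
      \<open>i\<close> with \<open>M i i\<close> and column \<open>j\<close> with
      \<open>M j j\<close>.\<close>
    have "(M i i, M j j) \<in> \<psi>" if "i \<in> {1..m}" "j \<in> {1..m}" for i j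
    proof (rule transD[OF trans])
      show "(M i i, M i j) \<in> \<psi>" "(M i j, M j j) \<in> \<psi>"
        using rows cols that by (auto simp: blow_up_def)
    qed
    with M show "(\<lambda>i\<in>{1..m}. M i i) \<in> blow_up m A \<psi>"
      by (auto simp: blow_up_def tuples_def)
  qed
  ultimately show ?thesis
    using refl by (auto simp: gEq_def reflexive_rel_def blow_up_def tuples_def)
qed

lemma bin_sym_part_blow_up:
  assumes "\<psi> \<in> Eq A" "2 \<le> m"
  shows "bin_sym_part m A (blow_up m A \<psi>) = \<psi>"
proof -
  have eq: "\<psi> \<subseteq> A \<times> A" "\<And>x. x \<in> A \<Longrightarrow> (x, x) \<in> \<psi>" "sym \<psi>"
    using assms(1) by (auto simp: Eq_def equiv_def refl_on_def)
  show ?thesis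
  proof (intro subset_antisym subrelI)
    fix a b assume "(a, b) \<in> bin_sym_part m A (blow_up m A \<psi>)"
    \<comment> \<open>Since \<open>2 \<le> m\<close>, this tuple takes both values, and the pair
      \<open>(a, b)\<close> can be read off at places \<open>1\<close> and \<open>2\<close>.\<close>
    then have "(\<lambda>i\<in>{1..m}. if i = 1 then a else b) \<in> blow_up m A \<psi>"
      by (rule restrict_mem_of_bin_sym_part) simp
    then have "\<forall>i\<in>{1..m}. \<forall>j\<in>{1..m}. (if i = 1 then a else b, if j = 1 then a else b) \<in> \<psi>"
      by (simp add: blow_up_def)
    from this[THEN bspec[of _ _ 1], THEN bspec[of _ _ 2]] show "(a, b) \<in> \<psi>"
      using assms(2) by simp
  next
    fix a b assume ab: "(a, b) \<in> \<psi>"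
    then have A: "a \<in> A" "b \<in> A" and "(b, a) \<in> \<psi>"
      using eq(1,3) by (auto dest: symD)
    then have "\<And>x y. x \<in> {a, b} \<Longrightarrow> y \<in> {a, b} \<Longrightarrow> (x, y) \<in> \<psi>"
      using ab eq(2) by auto
    moreover have "tuples m {a, b} \<subseteq> tuples m A"
      unfolding tuples_def using A by (intro PiE_mono) auto
    ultimately have "tuples m {a, b} \<subseteq> blow_up m A \<psi>"
      by (auto simp only: blow_up_def subset_iff tuples_def PiE_iff mem_Collect_eq)
    then show "(a, b) \<in> bin_sym_part m A (blow_up m A \<psi>)"
      using A by (simp add: bin_sym_part_def)
  qed
qed

lemma blow_up_bin_sym_part:
  assumes "\<theta> \<in> gEq m A" "2 \<le> m"
  shows "blow_up m A (bin_sym_part m A \<theta>) = \<theta>"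
  using gEq_iff_bin_sym_part[OF assms] gEq_tuples[OF assms(1)] by (auto simp: blow_up_def)

section \<open>Lattices of sets ordered by inclusion\<close>

lemma inclusion_order_simps [simp]:
  "carrier (inclusion_order S) = S" "le (inclusion_order S) = (\<subseteq>)" "eq (inclusion_order S) = (=)"
  by (simp_all add: inclusion_order_def)

lemma partial_order_inclusion_order: "partial_order (inclusion_order S)"
  by unfold_locales auto

text \<open>\<open>Upper\<close> takes only members of the carrier into account, so \<open>x\<close>
  and \<open>y\<close> must lie in \<open>S\<close> for both to count as constraints.\<close>

lemma least_Upper_inclusion_order:
  assumes "x \<in> S" "y \<in> S"
  shows "least (inclusion_order S) s (Upper (inclusion_order S) {x, y}) \<longleftrightarrow>
    s \<in> S \<and> x \<subseteq> s \<and> y \<subseteq> s \<and> (\<forall>z\<in>S. x \<subseteq> z \<longrightarrow> y \<subseteq> z \<longrightarrow> s \<subseteq> z)"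
proof -
  have "Upper (inclusion_order S) {x, y} = {z \<in> S. x \<subseteq> z \<and> y \<subseteq> z}"
    using assms by (simp add: Upper_def) blast
  then show ?thesis
    by (simp add: least_def subset_iff[where B = S] Ball_def) blast
qed

lemma greatest_Lower_inclusion_order:
  assumes "x \<in> S" "y \<in> S"
  shows "greatest (inclusion_order S) s (Lower (inclusion_order S) {x, y}) \<longleftrightarrow>
    s \<in> S \<and> s \<subseteq> x \<and> s \<subseteq> y \<and> (\<forall>z\<in>S. z \<subseteq> x \<longrightarrow> z \<subseteq> y \<longrightarrow> z \<subseteq> s)"
proof -
  have "Lower (inclusion_order S) {x, y} = {z \<in> S. z \<subseteq> x \<and> z \<subseteq> y}"
    using assms by (simp add: Lower_def) blast
  then show ?thesis
    by (simp add: greatest_def subset_iff[where B = S] Ball_def) blast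
qed

text \<open>Meets are intersections, and the join is the intersection of all common upper bounds in
  \<open>S\<close>, a family that is nonempty because it contains \<open>T\<close>.\<close>

lemma lattice_inclusion_orderI:
  assumes Inter: "\<And>X. X \<subseteq> S \<Longrightarrow> X \<noteq> {} \<Longrightarrow> \<Inter>X \<in> S"
    and top: "T \<in> S" "\<And>x. x \<in> S \<Longrightarrow> x \<subseteq> T"
  shows "lattice (inclusion_order S)"
proof -
  interpret partial_order "inclusion_order S"
    by (rule partial_order_inclusion_order)
  show ?thesis
  proof unfold_locales
    fix x y assume "x \<in> carrier (inclusion_order S)" "y \<in> carrier (inclusion_order S)"
    then have S: "x \<in> S" "y \<in> S" by simp_all
    let ?U = "{z \<in> S. x \<subseteq> z \<and> y \<subseteq> z}"
    have "T \<in> ?U"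
      using top S by simp
    then have "\<Inter>?U \<in> S"
      by (intro Inter) auto
    then show "\<exists>s. least (inclusion_order S) s (Upper (inclusion_order S) {x, y})"
      unfolding least_Upper_inclusion_order[OF S] by (intro exI[of _ "\<Inter>?U"]) auto
    have "\<Inter>{x, y} \<in> S"
      using S by (intro Inter) auto
    then show "\<exists>s. greatest (inclusion_order S) s (Lower (inclusion_order S) {x, y})"
      unfolding greatest_Lower_inclusion_order[OF S] by (intro exI[of _ "\<Inter>{x, y}"]) auto
  qed
qed

section \<open>The lattice of equivalence relations\<close>

lemma lattice_Eq: "lattice (inclusion_order (Eq A))"
proof (rule lattice_inclusion_orderI)
  show "A \<times> A \<in> Eq A"
    by (auto simp: Eq_def intro!: equivI refl_onI symI transI)
  show "\<psi> \<subseteq> A \<times> A" if "\<psi> \<in> Eq A" for \<psi>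
    using that by (auto simp: Eq_def equiv_def refl_on_def)
  show "\<Inter>X \<in> Eq A" if X: "X \<subseteq> Eq A" "X \<noteq> {}" for X
  proof -
    have \<psi>: "equiv A \<psi>" if "\<psi> \<in> X" for \<psi>
      using X(1) that by (auto simp: Eq_def)
    \<comment> \<open>Nonemptiness of \<open>X\<close> matters here: the intersection of the empty
      family is the universal relation on the whole type.\<close>
    have "\<Inter>X \<subseteq> A \<times> A"
      using X(2) \<psi> equiv_type by fast
    moreover have "refl_on A (\<Inter>X)"
      using calculation \<psi> by (auto simp: equiv_def refl_on_def)
    moreover have "sym (\<Inter>X)"
      using \<psi> by (intro symI) (auto simp: equiv_def dest: symD)
    moreover have "trans (\<Inter>X)"
    proof (intro transI InterI)
      fix a b c \<psi> assume "(a, b) \<in> \<Inter>X" "(b, c) \<in> \<Inter>X" "\<psi> \<in> X"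
      then show "(a, c) \<in> \<psi>"
        using \<psi>[of \<psi>] by (auto simp: equiv_def dest: transD)
    qed
    ultimately show ?thesis
      by (auto simp: Eq_def intro!: equivI)
  qed
qed

section \<open>Mutually inverse monotone maps between families of sets\<close>

context
  fixes S :: "'b set set" and T :: "'c set set" and f g
  assumes f: "\<And>x. x \<in> S \<Longrightarrow> f x \<in> T" and g: "\<And>y. y \<in> T \<Longrightarrow> g y \<in> S"
    and gf: "\<And>x. x \<in> S \<Longrightarrow> g (f x) = x" and fg: "\<And>y. y \<in> T \<Longrightarrow> f (g y) = y"
    and f_mono: "\<And>x x'. x \<subseteq> x' \<Longrightarrow> f x \<subseteq> f x'"
    and g_mono: "\<And>y y'. y \<subseteq> y' \<Longrightarrow> g y \<subseteq> g y'"
begin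

text \<open>An upper bound \<open>z\<close> of \<open>f x\<close> and \<open>f y\<close> pulls back
  to the upper bound \<open>g z\<close> of \<open>x\<close> and \<open>y\<close>. Hence
  \<open>s \<subseteq> g z\<close>, and applying \<open>f\<close> gives
  \<open>f s \<subseteq> z\<close>.\<close>

lemma least_Upper_inclusion_order_image:
  assumes S: "x \<in> S" "y \<in> S"
    and s: "least (inclusion_order S) s (Upper (inclusion_order S) {x, y})"
  shows "least (inclusion_order T) (f s) (Upper (inclusion_order T) {f x, f y})"
proof -
  have s: "s \<in> S" "x \<subseteq> s" "y \<subseteq> s" "\<And>z. z \<in> S \<Longrightarrow> x \<subseteq> z \<Longrightarrow> y \<subseteq> z \<Longrightarrow> s \<subseteq> z"
    using s by (simp_all add: least_Upper_inclusion_order[OF S])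
  have "f s \<subseteq> z" if z: "z \<in> T" "f x \<subseteq> z" "f y \<subseteq> z" for z
  proof -
    have "s \<subseteq> g z"
      using z g_mono[of _ z] gf S by (intro s(4) g) metis+
    then show ?thesis
      using f_mono fg[OF z(1)] by metis
  qed
  then show ?thesis
    using s f_mono by (simp add: least_Upper_inclusion_order f S)
qed

lemma greatest_Lower_inclusion_order_image:
  assumes S: "x \<in> S" "y \<in> S"
    and s: "greatest (inclusion_order S) s (Lower (inclusion_order S) {x, y})"
  shows "greatest (inclusion_order T) (f s) (Lower (inclusion_order T) {f x, f y})"
proof -
  have s: "s \<in> S" "s \<subseteq> x" "s \<subseteq> y" "\<And>z. z \<in> S \<Longrightarrow> z \<subseteq> x \<Longrightarrow> z \<subseteq> y \<Longrightarrow> z \<subseteq> s"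
    using s by (simp_all add: greatest_Lower_inclusion_order[OF S])
  have "z \<subseteq> f s" if z: "z \<in> T" "z \<subseteq> f x" "z \<subseteq> f y" for z
  proof -
    have "g z \<subseteq> s"
      using z g_mono[of z] gf S by (intro s(4) g) metis+
    then show ?thesis
      using f_mono fg[OF z(1)] by metis
  qed
  then show ?thesis
    using s f_mono by (simp add: greatest_Lower_inclusion_order f S)
qed

text \<open>Since \<open>x = f (g x)\<close> on \<open>T\<close>, bounds of \<open>x\<close> and
  \<open>y\<close> are images under \<open>f\<close> of bounds of \<open>g x\<close> and
  \<open>g y\<close>.\<close>

lemma lattice_inclusion_order_image:
  assumes "lattice (inclusion_order S)"
  shows "lattice (inclusion_order T)"
proof -
  interpret S: lattice "inclusion_order S" by fact
  interpret T: partial_order "inclusion_order T"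
    by (rule partial_order_inclusion_order)
  show ?thesis
  proof unfold_locales
    fix x y assume "x \<in> carrier (inclusion_order T)" "y \<in> carrier (inclusion_order T)"
    then have T: "x \<in> T" "y \<in> T" by simp_all
    have S: "g x \<in> S" "g y \<in> S" using T g by simp_all
    show "\<exists>s. least (inclusion_order T) s (Upper (inclusion_order T) {x, y})"
      using S.sup_of_two_exists[of "g x" "g y"] S least_Upper_inclusion_order_image[OF S] fg T
      by auto
    show "\<exists>s. greatest (inclusion_order T) s (Lower (inclusion_order T) {x, y})"
      using S.inf_of_two_exists[of "g x" "g y"] S greatest_Lower_inclusion_order_image[OF S] fg T
      by auto
  qed
qed

text \<open>The image of a join and the join of the images are least upper bounds of the same pair,
  hence equal; dually for meets.\<close>

lemma lattice_iso_inclusion_order: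
  assumes "lattice (inclusion_order S)"
  shows "lattice_iso (inclusion_order S) (inclusion_order T) f"
proof -
  interpret S: lattice "inclusion_order S" by fact
  interpret T: lattice "inclusion_order T"
    by (rule lattice_inclusion_order_image) fact
  have "f (x \<squnion>\<^bsub>inclusion_order S\<^esub> y) = f x \<squnion>\<^bsub>inclusion_order T\<^esub> f y"
    "f (x \<sqinter>\<^bsub>inclusion_order S\<^esub> y) = f x \<sqinter>\<^bsub>inclusion_order T\<^esub> f y"
    if xy: "x \<in> S" "y \<in> S" for x y
  proof -
    show "f (x \<squnion>\<^bsub>inclusion_order S\<^esub> y) = f x \<squnion>\<^bsub>inclusion_order T\<^esub> f y"
    proof (rule T.least_unique)
      show "least (inclusion_order T) (f (x \<squnion>\<^bsub>inclusion_order S\<^esub> y))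
          (Upper (inclusion_order T) {f x, f y})"
        by (rule S.joinI) (use xy in \<open>auto intro: least_Upper_inclusion_order_image\<close>)
      show "least (inclusion_order T) (f x \<squnion>\<^bsub>inclusion_order T\<^esub> f y)
          (Upper (inclusion_order T) {f x, f y})"
        by (rule T.joinI) (use xy f in auto)
    qed
    show "f (x \<sqinter>\<^bsub>inclusion_order S\<^esub> y) = f x \<sqinter>\<^bsub>inclusion_order T\<^esub> f y"
    proof (rule T.greatest_unique)
      show "greatest (inclusion_order T) (f (x \<sqinter>\<^bsub>inclusion_order S\<^esub> y))
          (Lower (inclusion_order T) {f x, f y})"
        by (rule S.meetI) (use xy in \<open>auto intro: greatest_Lower_inclusion_order_image\<close>)
      show "greatest (inclusion_order T) (f x \<sqinter>\<^bsub>inclusion_order T\<^esub> f y)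
          (Lower (inclusion_order T) {f x, f y})"
        by (rule T.meetI) (use xy f in auto)
    qed
  qed
  moreover have "bij_betw f S T"
    by (rule bij_betw_byWitness[where f' = g]) (use f g gf fg in auto)
  ultimately show ?thesis
    by (simp add: lattice_iso_def join_pres_def meet_pres_def
        S.lattice_axioms T.lattice_axioms)
qed

end

section \<open>The isomorphisms between the two lattices\<close>

lemma blow_up_mono: "\<psi> \<subseteq> \<psi>' \<Longrightarrow> blow_up m A \<psi> \<subseteq> blow_up m A \<psi>'"
  by (auto simp: blow_up_def)

lemma bin_sym_part_mono: "\<rho> \<subseteq> \<rho>' \<Longrightarrow> bin_sym_part m A \<rho> \<subseteq> bin_sym_part m A \<rho>'"
  by (auto simp: bin_sym_part_def)

theorem theorem3p6:
  fixes A :: "'a set" and m :: nat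
  assumes "finite A" and "A \<noteq> {}" and "2 \<le> m"
  shows
    "(\<forall>\<theta>\<in>gEq m A.
        (\<forall>a\<in>tuples m A.
           a \<in> \<theta> \<longleftrightarrow> (\<forall>i\<in>{1..m}. \<forall>j\<in>{1..m}. (a i, a j) \<in> bin_sym_part m A \<theta>)) \<and>
        abs_part m A \<theta> = \<theta> \<and> absolutely_symmetric m \<theta>) \<and>
     (\<forall>\<psi>\<in>Eq A. blow_up m A \<psi> \<in> gEq m A) \<and>
     (\<forall>\<psi>\<in>Eq A. bin_sym_part m A (blow_up m A \<psi>) = \<psi>) \<and>
     (\<forall>\<theta>\<in>gEq m A. blow_up m A (bin_sym_part m A \<theta>) = \<theta>) \<and>
     lattice_iso (inclusion_order (Eq A)) (inclusion_order (gEq m A)) (blow_up m A) \<and>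
     lattice_iso (inclusion_order (gEq m A)) (inclusion_order (Eq A)) (bin_sym_part m A)"
proof -
  note maps = blow_up_gEq[of _ A m] bin_sym_part_Eq[OF _ \<open>2 \<le> m\<close>, of _ A]
  note inverse = bin_sym_part_blow_up[OF _ \<open>2 \<le> m\<close>, of _ A]
    blow_up_bin_sym_part[OF _ \<open>2 \<le> m\<close>, of _ A]
  note mono = blow_up_mono[of _ _ m A] bin_sym_part_mono[of _ _ m A]
  \<comment> \<open>The lattice property is carried over from \<open>Eq A\<close> along
    \<open>blow_up\<close>.\<close>
  have "lattice (inclusion_order (gEq m A))"
    using maps inverse mono lattice_Eq
    by (rule lattice_inclusion_order_image[where f = "blow_up m A" and g = "bin_sym_part m A"])
  \<comment> \<open>The facts are listed in swapped order because the two maps now exchange the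
    roles of \<open>f\<close> and \<open>g\<close>.\<close>
  with maps(2,1) inverse(2,1) mono(2,1)
  have "lattice_iso (inclusion_order (gEq m A)) (inclusion_order (Eq A)) (bin_sym_part m A)"
    by (rule lattice_iso_inclusion_order[where g = "blow_up m A"])
  moreover have "lattice_iso (inclusion_order (Eq A)) (inclusion_order (gEq m A)) (blow_up m A)"
    using maps inverse mono lattice_Eq
    by (rule lattice_iso_inclusion_order[where g = "bin_sym_part m A"])
  ultimately show ?thesis
    using maps(1) inverse gEq_iff_bin_sym_part[OF _ \<open>2 \<le> m\<close>, of _ A]
      abs_part_gEq[OF _ \<open>2 \<le> m\<close>, of _ A] gEq_absolutely_symmetric[OF _ \<open>2 \<le> m\<close>, of _ A]
    by (intro conjI ballI)
qed

end
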